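(* Let $A\in\mathcal{A}_n$ be a binary matrix and let $t>0$ be such that \[ \text{for all } 1\le i\le j\le n:\quad 1_{\mathrm{UR}}(i,j)<t \ \text{ or } \ 0_{\mathrm{LL}}(i,j)<t. \] Let $R$ be the symmetric binary $n\times n$ matrix defined, for $1\le i\le j\le n$, by $R_{i,j}=R_{j,i}=0$ if $i=1$ or $j=n$, and otherwise $R_{i,j}=R_{j,i}=1$ if $1_{\mathrm{UR}}(i,j)\ge t$ and $R_{i,j}=R_{j,i}=0$ if $1_{\mathrm{UR}}(i,j)<t$. Then \[ \|A-R\|_1\le\frac{16\sqrt{t}+4}{n}. \]
   Context: For a positive integer $n$, $\mathcal{A}_n$ denotes the set of all symmetric $n\times n$ real matrices with entries in $[0,1]$; a matrix is binary if its entries lie in $\{0,1\}$. The normalized $\ell^1$-norm of an $n\times n$ matrix $A$ is $\|A\|_1=\frac{1}{n^2}\sum_{i,j=1}^n|A_{i,j}|$. For $1\le a\le b\le n$ define the regions $\mathrm{UR}(a,b)=\{(i,j): 1\le i<a,\ b<j\le n\}$ and $\mathrm{LL}(a,b)=\{(i,j): a\le i\le j\le b\}$, and for a binary matrix $A$ let $1_{\mathrm{UR}}(a,b)$ be the number of cells $(i,j)\in\mathrm{UR}(a,b)$ with $A_{i,j}=1$ and $0_{\mathrm{LL}}(a,b)$ the number of cells $(i,j)\in\mathrm{LL}(a,b)$ with $A_{i,j}=0$. (The matrix $R$ described is the output of the paper's Algorithm 1 on input $A$ with threshold $t$.) *)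

theory Defs
  imports Complex_Main
begin

text \<open>
  An $n \times n$ real matrix is a function \<open>nat \<Rightarrow> nat \<Rightarrow> real\<close> of which only the entries with
  row and column index in \<open>{1..n}\<close> are meaningful; the dimension \<open>n\<close> is passed explicitly.
  Indices start at 1, and the difference of two matrices is the pointwise one, \<open>A - B\<close>.
\<close>

definition sym_unit_mats :: "nat \<Rightarrow> (nat \<Rightarrow> nat \<Rightarrow> real) set" where
  "sym_unit_mats n =
     {A. \<forall>i\<in>{1..n}. \<forall>j\<in>{1..n}. A i j = A j i \<and> A i j \<in> {0..1}}"

definition binary_mat :: "nat \<Rightarrow> (nat \<Rightarrow> nat \<Rightarrow> real) \<Rightarrow> bool" where
  "binary_mat n A \<longleftrightarrow> (\<forall>i\<in>{1..n}. \<forall>j\<in>{1..n}. A i j \<in> {0, 1})"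

definition norm_l1 :: "nat \<Rightarrow> (nat \<Rightarrow> nat \<Rightarrow> real) \<Rightarrow> real" where
  "norm_l1 n A = 1 / (real n)\<^sup>2 * (\<Sum>i=1..n. \<Sum>j=1..n. \<bar>A i j\<bar>)"

definition UR :: "nat \<Rightarrow> nat \<Rightarrow> nat \<Rightarrow> (nat \<times> nat) set" where
  "UR n a b = {(i, j). 1 \<le> i \<and> i < a \<and> b < j \<and> j \<le> n}"

definition LL :: "nat \<Rightarrow> nat \<Rightarrow> (nat \<times> nat) set" where
  "LL a b = {(i, j). a \<le> i \<and> i \<le> j \<and> j \<le> b}"

definition ones_UR :: "nat \<Rightarrow> (nat \<Rightarrow> nat \<Rightarrow> real) \<Rightarrow> nat \<Rightarrow> nat \<Rightarrow> nat" where
  "ones_UR n A a b = card {(i, j) \<in> UR n a b. A i j = 1}"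

definition zeros_LL :: "(nat \<Rightarrow> nat \<Rightarrow> real) \<Rightarrow> nat \<Rightarrow> nat \<Rightarrow> nat" where
  "zeros_LL A a b = card {(i, j) \<in> LL a b. A i j = 0}"

definition R_upper :: "nat \<Rightarrow> real \<Rightarrow> (nat \<Rightarrow> nat \<Rightarrow> real) \<Rightarrow> nat \<Rightarrow> nat \<Rightarrow> real" where
  "R_upper n t A i j =
     (if i = 1 \<or> j = n then 0
      else if real (ones_UR n A i j) \<ge> t then 1 else 0)"

definition R_mat :: "nat \<Rightarrow> real \<Rightarrow> (nat \<Rightarrow> nat \<Rightarrow> real) \<Rightarrow> nat \<Rightarrow> nat \<Rightarrow> real" where
  "R_mat n t A i j = (if i \<le> j then R_upper n t A i j else R_upper n t A j i)"

end

theory Submission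
  imports Defs
begin

text \<open>
  Up to reflection in the diagonal, an error of \<open>R\<close> is either a one of \<open>A\<close> with fewer than \<open>t\<close>
  ones of \<open>A\<close> to its upper right, or (by the hypothesis on \<open>A\<close>) a zero of \<open>A\<close> with fewer than \<open>t\<close>
  zeros of \<open>A\<close> to its lower left. Either kind of cell is rare: delete from a set of cells the \<open>m\<close>
  extreme ones of each column, and then the \<open>m\<close> extreme remaining ones of each row. At most
  \<open>2nm\<close> cells are deleted, and a surviving cell sees \<open>m\<close> others in its row, each of which sees \<open>m\<close>
  others in its column, hence \<open>m\<^sup>2\<close> cells in its quadrant. Take \<open>m\<close> about \<open>sqrt t\<close>.
\<close>

text \<open>Counting predecessors ranks the elements: \<open>r\<close> is a strict linear order on
  \<open>X\<close>, so the count strictly increases along \<open>r\<close>, is injective on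
  \<open>X\<close>, and takes each of the \<open>m\<close> values below \<open>m\<close> at most
  once. The relation is left general because columns are trimmed along \<open><\<close> and rows
  along its converse.\<close>

lemma card_few_predecessors_le:
  assumes "finite X" "transp r" "irreflp r"
    and total: "\<And>x y. x \<in> X \<Longrightarrow> y \<in> X \<Longrightarrow> x \<noteq> y \<Longrightarrow> r x y \<or> r y x"
  shows "card {x \<in> X. card {y \<in> X. r y x} < m} \<le> m"
proof -
  have less: "card {z \<in> X. r z x} < card {z \<in> X. r z y}" if "x \<in> X" "r x y" for x y
  proof (rule psubset_card_mono)
    show "{z \<in> X. r z x} \<subset> {z \<in> X. r z y}"
      using that assms(2,3) by (auto dest: transpD irreflpD)
  qed (use assms(1) in simp)
  have "inj_on (\<lambda>x. card {y \<in> X. r y x}) X"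
  proof (rule inj_onI, rule ccontr)
    fix x y
    assume "x \<in> X" "y \<in> X" "x \<noteq> y" and "card {z \<in> X. r z x} = card {z \<in> X. r z y}"
    then show False
      using total[of x y] less[of x y] less[of y x] by auto
  qed
  then have "inj_on (\<lambda>x. card {y \<in> X. r y x}) {x \<in> X. card {y \<in> X. r y x} < m}"
    by (rule inj_on_subset) auto
  then have "card {x \<in> X. card {y \<in> X. r y x} < m} \<le> card {..<m}"
    by (rule card_inj_on_le) auto
  then show ?thesis by simp
qed

text \<open>The two counts fit the two shapes of region: \<open>UR\<close> omits the row and column
  of its corner, while \<open>LL\<close> contains them, which adds one to both factors.\<close>

lemma exists_rich_quadrant:
  fixes S :: "('a::linorder \<times> 'b::linorder) set"
  assumes "finite I" "finite J" "S \<subseteq> I \<times> J" "(card I + card J) * m < card S"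
  obtains a b where "(a, b) \<in> S"
    "m\<^sup>2 \<le> card {(x, y) \<in> S. x < a \<and> b < y}"
    "(Suc m)\<^sup>2 \<le> card {(x, y) \<in> S. x \<le> a \<and> b \<le> y}"
proof -
  have finS: "finite S"
    using assms(1-3) by (meson finite_SigmaI finite_subset)
  define col where "col y = {x. (x, y) \<in> S}" for y
  define S1 where "S1 = {(x, y) \<in> S. m \<le> card {x' \<in> col y. x' < x}}"
  define row where "row x = {y. (x, y) \<in> S1}" for x
  \<comment> \<open>Rows are trimmed inside \<open>S1\<close>, so every cell counted in a row still
    has \<open>m\<close> smaller cells in its full column of \<open>S\<close>.\<close>
  define S2 where "S2 = {(x, y) \<in> S1. m \<le> card {y' \<in> row x. y < y'}}"
  have sub: "S2 \<subseteq> S1" "S1 \<subseteq> S"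
    by (auto simp: S1_def S2_def)
  have fin_col: "finite (col y)" for y
    by (rule finite_subset[of _ I]) (use assms in \<open>auto simp: col_def\<close>)
  have fin_row: "finite (row x)" for x
    by (rule finite_subset[of _ J]) (use assms sub in \<open>auto simp: row_def\<close>)
  have "card (S - S1) \<le> card J * m"
  proof -
    let ?L = "\<lambda>y. {x \<in> col y. card {x' \<in> col y. x' < x} < m}"
    have L: "finite (?L y)" "card (?L y) \<le> m" for y
      using fin_col by (auto intro!: card_few_predecessors_le simp: transp_def irreflp_def)
    \<comment> \<open>\<open>Sigma J ?L\<close> lists the second coordinate first, hence the
      swap.\<close>
    have "S - S1 \<subseteq> prod.swap ` Sigma J ?L"
      using assms(3) by (force simp: S1_def col_def)
    then have "card (S - S1) \<le> card (Sigma J ?L)"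
      using L assms(2) by (intro surj_card_le) auto
    also have "\<dots> = (\<Sum>y\<in>J. card (?L y))"
      using L assms(2) by (intro card_SigmaI) auto
    also have "\<dots> \<le> card J * m"
      using sum_bounded_above[of J "\<lambda>y. card (?L y)" m] L by simp
    finally show ?thesis .
  qed
  moreover have "card (S1 - S2) \<le> card I * m"
  proof -
    let ?L = "\<lambda>x. {y \<in> row x. card {y' \<in> row x. y < y'} < m}"
    have L: "finite (?L x)" "card (?L x) \<le> m" for x
      using fin_row
      by (simp, intro card_few_predecessors_le[where r = "\<lambda>y' y. y < y'"])
        (auto simp: transp_def irreflp_def)
    have "S1 - S2 \<subseteq> Sigma I ?L"
      using assms(3) sub by (force simp: S2_def row_def)
    then have "card (S1 - S2) \<le> card (Sigma I ?L)"
      using L assms(1) by (intro card_mono) auto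
    also have "\<dots> = (\<Sum>x\<in>I. card (?L x))"
      using L assms(1) by (intro card_SigmaI) auto
    also have "\<dots> \<le> card I * m"
      using sum_bounded_above[of I "\<lambda>x. card (?L x)" m] L by simp
    finally show ?thesis .
  qed
  ultimately have "card ((S - S1) \<union> (S1 - S2)) < card S"
    using assms(4) card_Un_le[of "S - S1" "S1 - S2"] by (simp add: algebra_simps)
  \<comment> \<open>If nothing survived, the deleted cells would be all of \<open>S\<close>.\<close>
  then have "S2 \<noteq> {}"
    using sub by (metis Diff_empty Un_Diff_cancel2 less_irrefl sup.absorb1)
  then obtain a b where ab: "(a, b) \<in> S2"
    by (metis ex_in_conv surj_pair)
  \<comment> \<open>At least \<open>k\<close> columns \<open>y\<close>, each contributing at least
    \<open>k\<close> cells. It is used with \<open>k = m\<close> for the open quadrant and with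
    \<open>k = Suc m\<close> for the closed one.\<close>
  have quadrant: "k\<^sup>2 \<le> card Q"
    if "finite Y" "k \<le> card Y" "\<And>y. y \<in> Y \<Longrightarrow> finite (X y) \<and> k \<le> card (X y)"
      "finite Q" "prod.swap ` Sigma Y X \<subseteq> Q"
    for k X Q and Y :: "'b set"
  proof -
    have "k\<^sup>2 \<le> card Y * k"
      using that(2) by (simp add: power2_eq_square)
    also have "\<dots> \<le> (\<Sum>y\<in>Y. card (X y))"
      using sum_bounded_below[of Y k "\<lambda>y. card (X y)"] that(3) by simp
    also have "\<dots> = card (prod.swap ` Sigma Y X)"
      using that(1,3) by (simp add: card_image)
    also have "\<dots> \<le> card Q"
      using that(4,5) by (rule card_mono)
    finally show ?thesis .
  qed
  let ?X = "\<lambda>y. {x \<in> col y. x < a}" and ?Y = "{y \<in> row a. b < y}"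
  have X: "m \<le> card (?X y)" if "y \<in> row a" for y
    using that by (simp add: row_def S1_def)
  have Y: "m \<le> card ?Y"
    using ab by (simp add: S2_def)
  have b: "b \<in> row a"
    using ab sub by (auto simp: row_def)
  have a: "a \<in> col y" if "y \<in> row a" for y
    using that sub by (auto simp: row_def col_def)
  have finQ: "finite {(x, y) \<in> S. P x y}" for P
    by (rule finite_subset[OF _ finS]) auto
  show thesis
  proof
    show "(a, b) \<in> S" using ab sub by auto
    show "m\<^sup>2 \<le> card {(x, y) \<in> S. x < a \<and> b < y}"
      by (rule quadrant[of ?Y _ ?X]) (use X Y fin_col fin_row finQ in \<open>auto simp: col_def\<close>)
    show "(Suc m)\<^sup>2 \<le> card {(x, y) \<in> S. x \<le> a \<and> b \<le> y}"
      \<comment> \<open>Column \<open>b\<close> joins the columns, and the cell of row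
        \<open>a\<close> joins each of them.\<close>
      by (rule quadrant[of "insert b ?Y" _ "\<lambda>y. insert a (?X y)"])
        (use X Y a b fin_col fin_row finQ in \<open>auto simp: col_def\<close>)
  qed
qed

text \<open>With more such cells, one of them would have \<open>m\<^sup>2\<close> others in its open
  quadrant. These are ones of \<open>A\<close> in its \<open>UR\<close>, and there are at least
  \<open>t\<close> of them, a contradiction.\<close>

lemma card_sparse_UR_le:
  assumes "t \<le> (real m)\<^sup>2"
  shows "card {(i, j). 1 \<le> i \<and> i \<le> j \<and> j \<le> n \<and> A i j = 1 \<and> real (ones_UR n A i j) < t}
    \<le> 2 * n * m" (is "card ?P \<le> _")
proof (rule ccontr)
  have "?P \<subseteq> {1..n} \<times> {1..n}" by auto
  moreover assume "\<not> card ?P \<le> 2 * n * m"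
  then have "(card {1..n} + card {1..n}) * m < card ?P"
    by (simp add: mult_2)
  ultimately obtain a b where ab: "(a, b) \<in> ?P"
    and le: "m\<^sup>2 \<le> card {(x, y) \<in> ?P. x < a \<and> b < y}"
    by (rule exists_rich_quadrant[OF finite_atLeastAtMost finite_atLeastAtMost])
  have "card {(x, y) \<in> ?P. x < a \<and> b < y} \<le> ones_UR n A a b"
    unfolding ones_UR_def
  proof (rule card_mono)
    show "finite {(i, j) \<in> UR n a b. A i j = 1}"
      by (rule finite_subset[of _ "{1..n} \<times> {1..n}"]) (use ab in \<open>auto simp: UR_def\<close>)
  qed (auto simp: UR_def)
  with le have "m\<^sup>2 \<le> ones_UR n A a b"
    by (rule order_trans)
  then have "(real m)\<^sup>2 \<le> real (ones_UR n A a b)"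
    by (simp flip: of_nat_power del: of_nat_Suc)
  with ab assms show False by simp
qed

text \<open>Transposing the zeros turns the lower left quadrant into an upper right one.\<close>

lemma card_sparse_LL_le:
  assumes "t \<le> (real (Suc m))\<^sup>2"
  shows "card {(i, j). 1 \<le> i \<and> i \<le> j \<and> j \<le> n \<and> A i j = 0 \<and> real (zeros_LL A i j) < t}
    \<le> 2 * n * m" (is "card ?Q \<le> _")
proof (rule ccontr)
  let ?Q' = "prod.swap ` ?Q"
  have "?Q' \<subseteq> {1..n} \<times> {1..n}" by auto
  moreover assume "\<not> card ?Q \<le> 2 * n * m"
  then have "(card {1..n} + card {1..n}) * m < card ?Q'"
    by (simp add: card_image mult_2)
  \<comment> \<open>\<open>LL\<close> is closed, so the count \<open>(Suc m)\<^sup>2\<close>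
    applies: it reaches \<open>t\<close> although only \<open>m\<close> cells per line are
    trimmed.\<close>
  ultimately obtain b a where ba: "(b, a) \<in> ?Q'"
    and le: "(Suc m)\<^sup>2 \<le> card {(x, y) \<in> ?Q'. x \<le> b \<and> a \<le> y}"
    by (rule exists_rich_quadrant[OF finite_atLeastAtMost finite_atLeastAtMost])
  have "card {(x, y) \<in> ?Q'. x \<le> b \<and> a \<le> y} \<le> card {(i, j) \<in> LL a b. A i j = 0}"
  proof (rule surj_card_le)
    show "finite {(i, j) \<in> LL a b. A i j = 0}"
      by (rule finite_subset[of _ "{a..b} \<times> {a..b}"]) (auto simp: LL_def)
    show "{(x, y) \<in> ?Q'. x \<le> b \<and> a \<le> y} \<subseteq> prod.swap ` {(i, j) \<in> LL a b. A i j = 0}"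
      by (force simp: LL_def)
  qed
  with le have "(Suc m)\<^sup>2 \<le> zeros_LL A a b"
    unfolding zeros_LL_def by (rule order_trans)
  then have "(real (Suc m))\<^sup>2 \<le> real (zeros_LL A a b)"
    by (simp flip: of_nat_power del: of_nat_Suc)
  with ba assms show False by auto
qed

text \<open>On the border \<open>i = 1\<close> or \<open>j = n\<close> the region
  \<open>UR n i j\<close> is empty, so its count 0 lies below \<open>t\<close> and the threshold
  test gives 0 there too.\<close>

lemma R_upper_eq:
  assumes "t > 0"
  shows "R_upper n t A i j = (if t \<le> real (ones_UR n A i j) then 1 else 0)"
proof -
  have "UR n i j = {}" if "i = 1 \<or> j = n"
    using that by (auto simp: UR_def)
  then have "ones_UR n A i j = 0" if "i = 1 \<or> j = n"
    using that by (simp add: ones_UR_def)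
  with assms show ?thesis by (auto simp: R_upper_def)
qed

theorem theorem3p1:
  fixes n :: nat and A :: "nat \<Rightarrow> nat \<Rightarrow> real" and t :: real
  assumes "n \<ge> 1"
    and "A \<in> sym_unit_mats n"
    and "binary_mat n A"
    and "t > 0"
    and "\<And>i j. 1 \<le> i \<Longrightarrow> i \<le> j \<Longrightarrow> j \<le> n \<Longrightarrow>
           real (ones_UR n A i j) < t \<or> real (zeros_LL A i j) < t"
  shows "norm_l1 n (A - R_mat n t A) \<le> (16 * sqrt t + 4) / real n"
proof -
  let ?P = "{(i, j). 1 \<le> i \<and> i \<le> j \<and> j \<le> n \<and> A i j = 1 \<and> real (ones_UR n A i j) < t}"
  let ?Q = "{(i, j). 1 \<le> i \<and> i \<le> j \<and> j \<le> n \<and> A i j = 0 \<and> real (zeros_LL A i j) < t}"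
  let ?N = "{1..n} \<times> {1..n}"
  let ?D = "{(i, j) \<in> ?N. A i j \<noteq> R_mat n t A i j}"
  have sym: "A i j = A j i" if "i \<in> {1..n}" "j \<in> {1..n}" for i j
    using assms(2) that unfolding sym_unit_mats_def by blast
  have bin: "A i j = 0 \<or> A i j = 1" if "i \<in> {1..n}" "j \<in> {1..n}" for i j
    using assms(3) that unfolding binary_mat_def by blast
  have R: "R_mat n t A i j = 0 \<or> R_mat n t A i j = 1" for i j
    by (simp add: R_mat_def R_upper_eq[OF assms(4)])
  have finPQ: "finite (?P \<union> ?Q)"
    by (rule finite_subset[of _ ?N]) auto
  \<comment> \<open>A wrong 0 of \<open>R\<close> falls in \<open>?P\<close> by the threshold test.
    A wrong 1 has \<open>ones_UR\<close> at least \<open>t\<close>, so the hypothesis puts it in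
    \<open>?Q\<close>.\<close>
  have upper: "(i, j) \<in> ?P \<union> ?Q" if "1 \<le> i" "i \<le> j" "j \<le> n" "A i j \<noteq> R_mat n t A i j" for i j
    using that bin[of i j] assms(5)[of i j]
    by (auto simp: R_mat_def R_upper_eq[OF assms(4)] split: if_splits)
  have D_sub: "?D \<subseteq> (?P \<union> ?Q) \<union> prod.swap ` (?P \<union> ?Q)"
  proof
    fix p assume "p \<in> ?D"
    then obtain i j where p: "p = (i, j)" "i \<in> {1..n}" "j \<in> {1..n}"
      and ne: "A i j \<noteq> R_mat n t A i j" by auto
    show "p \<in> (?P \<union> ?Q) \<union> prod.swap ` (?P \<union> ?Q)"
    proof (cases "i \<le> j")
      case True
      then show ?thesis using upper[of i j] p ne by auto
    next
      case False
      then have "(j, i) \<in> ?P \<union> ?Q"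
        using p ne sym[of i j] by (intro upper) (auto simp: R_mat_def)
      then have "prod.swap (j, i) \<in> prod.swap ` (?P \<union> ?Q)" by (rule imageI)
      then show ?thesis using p(1) by simp
    qed
  qed
  have "card ?D \<le> card ((?P \<union> ?Q) \<union> prod.swap ` (?P \<union> ?Q))"
    using finPQ D_sub by (intro card_mono) auto
  also have "\<dots> \<le> card (?P \<union> ?Q) + card (prod.swap ` (?P \<union> ?Q))"
    by (rule card_Un_le)
  also have "\<dots> = 2 * card (?P \<union> ?Q)"
    by (subst card_image) auto
  also have "\<dots> \<le> 2 * (card ?P + card ?Q)"
    using card_Un_le by (rule mult_le_mono2)
  finally have D_card: "card ?D \<le> 2 * (card ?P + card ?Q)" .

  \<comment> \<open>Chosen so that \<open>m < sqrt t \<le> Suc m\<close>: ones are trimmed with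
    \<open>Suc m\<close>, zeros with \<open>m\<close>. As \<open>t > 0\<close>, the ceiling is
    positive and the subtraction is exact.\<close>
  define m where "m = nat \<lceil>sqrt t\<rceil> - 1"
  have "0 < \<lceil>sqrt t\<rceil>"
    using assms(4) by simp
  then have "real (Suc m) = of_int \<lceil>sqrt t\<rceil>"
    by (simp add: m_def)
  then have m: "sqrt t \<le> real (Suc m)" "real m < sqrt t"
    by linarith+
  have "t = (sqrt t)\<^sup>2"
    using assms(4) by simp
  also have "\<dots> \<le> (real (Suc m))\<^sup>2"
    using m(1) assms(4) by (intro power_mono) auto
  finally have "card ?P + card ?Q \<le> 2 * n * Suc m + 2 * n * m"
    by (intro add_mono card_sparse_UR_le card_sparse_LL_le)
  with D_card have "card ?D \<le> n * (8 * m + 4)"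
    by (simp add: algebra_simps)
  then have "real (card ?D) \<le> real (n * (8 * m + 4))"
    by (rule of_nat_mono)
  also have "\<dots> = real n * (8 * real m + 4)"
    by simp
  \<comment> \<open>Since \<open>m < sqrt t\<close>, already \<open>8 * sqrt t + 4\<close> would
    bound the factor.\<close>
  also have "\<dots> \<le> real n * (16 * sqrt t + 4)"
    using m(2) by (intro mult_left_mono) auto
  finally have D_le: "real (card ?D) \<le> real n * (16 * sqrt t + 4)" .

  have "(\<Sum>i=1..n. \<Sum>j=1..n. \<bar>(A - R_mat n t A) i j\<bar>)
      = (\<Sum>p\<in>?N. \<bar>A (fst p) (snd p) - R_mat n t A (fst p) (snd p)\<bar>)"
    by (simp add: sum.cartesian_product case_prod_beta)
  \<comment> \<open>Both matrices are binary, so the norm counts the cells where they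
    disagree.\<close>
  also have "\<dots> = (\<Sum>p\<in>?N. of_bool (p \<in> ?D))"
  proof (rule sum.cong[OF refl])
    fix p assume "p \<in> ?N"
    then show "\<bar>A (fst p) (snd p) - R_mat n t A (fst p) (snd p)\<bar> = of_bool (p \<in> ?D)"
      using bin[of "fst p" "snd p"] R[of "fst p" "snd p"] by (cases p) auto
  qed
  also have "\<dots> = real (card (?N \<inter> ?D))"
    by (subst sum_of_bool_eq) (auto simp: Int_def)
  also have "?N \<inter> ?D = ?D" by auto
  finally have "norm_l1 n (A - R_mat n t A) = real (card ?D) / (real n)\<^sup>2"
    by (simp add: norm_l1_def)
  also have "\<dots> \<le> real n * (16 * sqrt t + 4) / (real n)\<^sup>2"
    using D_le by (rule divide_right_mono) simp
  also have "\<dots> = (16 * sqrt t + 4) / real n"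
    using assms(1) by (simp add: power2_eq_square)
  finally show ?thesis .
qed

end
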